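(* Let $U_1=[u_1\ \cdots\ u_{m_1}]\in\mathbb{R}^{n_1\times m_1}$ and $U_2=[v_1\ \cdots\ v_{m_2}]\in\mathbb{R}^{n_2\times m_2}$ each have linearly independent columns. Let $P_1\in\mathbb{R}^{m_1m_2\times n_1}$ and $P_2\in\mathbb{R}^{m_1m_2\times n_2}$ be produced by the TEIM algorithm applied to $(U_1,U_2)$, and let $P_3\in\mathbb{R}^{m_1\times n_1}$, $P_4\in\mathbb{R}^{m_2\times n_2}$ be defined by $P_3^T(:,i)=P_1^T(:,(i-1)m_2+1)$ for $i\in\{1,\dots,m_1\}$ and $P_4^T(:,j)=P_2^T(:,j)$ for $j\in\{1,\dots,m_2\}$. Let $P_5\in\mathbb{R}^{m_1\times n_1}$ and $P_6\in\mathbb{R}^{m_2\times n_2}$ be the masking operators obtained by applying the DEIM algorithm to the columns of $U_1$ and $U_2$, respectively. Then $P_3=P_5$ and $P_4=P_6$.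
   Context: Notation. $A(:,i)$ is the $i$-th column of $A$; $e_p$ is the $p$-th standard unit vector of the appropriate dimension; $w(p)$ is the $p$-th entry of a vector $w$. Here $m_1\le n_1$ and $m_2\le n_2$ are positive integers. TEIM algorithm. It selects index pairs $(p_t,q_t)\in\{1,\dots,n_1\}\times\{1,\dots,n_2\}$ for $t=1,\dots,m_1m_2$, where iteration $t=(k-1)m_2+l$ corresponds to $k\in\{1,\dots,m_1\}$ (outer loop) and $l\in\{1,\dots,m_2\}$ (inner loop), and treats the rank-one matrix $B_t=u_kv_l^T\in\mathbb{R}^{n_1\times n_2}$. For $t=1$: $(p_1,q_1)=\operatorname{argmax}_{(i,j)}|(u_1v_1^T)_{ij}|$. For $t\ge 2$: let $c\in\mathbb{R}^{t-1}$ be the solution of the linear system $\sum_{s'=1}^{t-1}(B_{s'})_{p_sq_s}\,c_{s'}=(B_t)_{p_sq_s}$, $s=1,\dots,t-1$; put $R_t=B_t-\sum_{s'=1}^{t-1}c_{s'}B_{s'}$; and set $(p_t,q_t)=\operatorname{argmax}_{(i,j)}|(R_t)_{ij}|$. (These systems are uniquely solvable by the linear independence of the inputs.) The output is $P_1^T=[e_{p_1}\ \cdots\ e_{p_{m_1m_2}}]\in\mathbb{R}^{n_1\times m_1m_2}$ and $P_2^T=[e_{q_1}\ \cdots\ e_{q_{m_1m_2}}]\in\mathbb{R}^{n_2\times m_1m_2}$. DEIM algorithm. Given linearly independent $w_1,\dots,w_m\in\mathbb{R}^n$, it selects indices $\phi_1,\dots,\phi_m\in\{1,\dots,n\}$ as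 follows: $\phi_1=\operatorname{argmax}_i|w_1(i)|$; for $l=2,\dots,m$, let $c\in\mathbb{R}^{l-1}$ solve $\sum_{j=1}^{l-1}w_j(\phi_s)c_j=w_l(\phi_s)$, $s=1,\dots,l-1$, put $r=w_l-\sum_{j=1}^{l-1}c_jw_j$, and set $\phi_l=\operatorname{argmax}_i|r(i)|$. The resulting masking operator is the $m\times n$ matrix whose $l$-th row is $e_{\phi_l}^T$. Tie-breaking. For vectors, argmax denotes the smallest maximizing index; for matrices, it denotes the first maximizing position in column-major order (smallest column index, then smallest row index). *)

theory Defs
  imports Complex_Main "Jordan_Normal_Form.VS_Connect"
begin

text \<open>
  All indices are 0-based: the iteration number \<open>t = (k - 1) m\<^sub>2 + l\<close> of the usual
  1-based description becomes \<open>t = k * m\<^sub>2 + l\<close> with \<open>k < m\<^sub>1\<close> and \<open>l < m\<^sub>2\<close>.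
\<close>

text \<open>
  The library notion of linear independence is about sets of vectors; \<^const>\<open>distinct\<close>
  makes it a statement about the family of columns.
\<close>

definition lin_indep_cols :: "real mat \<Rightarrow> bool" where
  "lin_indep_cols U \<longleftrightarrow>
     distinct (cols U) \<and>
     \<not> LinearCombinations.module.lin_dep class_ring
         (module_vec TYPE(real) (dim_row U)) (set (cols U))"

definition argmax_abs_vec :: "real vec \<Rightarrow> nat" where
  "argmax_abs_vec v = (LEAST i. i < dim_vec v \<and> (\<forall>i'<dim_vec v. \<bar>v $ i'\<bar> \<le> \<bar>v $ i\<bar>))"

definition is_max_abs_pos :: "real mat \<Rightarrow> nat \<Rightarrow> nat \<Rightarrow> bool" where
  "is_max_abs_pos A i j \<longleftrightarrow>
     i < dim_row A \<and> j < dim_col A \<and>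
     (\<forall>i'<dim_row A. \<forall>j'<dim_col A. \<bar>A $$ (i', j')\<bar> \<le> \<bar>A $$ (i, j)\<bar>)"

text \<open>The first maximizing position in column-major order, as a pair (row, column).\<close>

definition argmax_abs_mat :: "real mat \<Rightarrow> nat \<times> nat" where
  "argmax_abs_mat A =
     (let j = (LEAST j. \<exists>i. is_max_abs_pos A i j);
          i = (LEAST i. is_max_abs_pos A i j)
      in (i, j))"

definition masking_mat :: "nat \<Rightarrow> nat list \<Rightarrow> real mat" where
  "masking_mat n is = mat_of_rows n (map (unit_vec n) is)"


text \<open>
  \<open>deim_indices W l\<close> lists the first \<open>l\<close> selected indices for the columns of \<open>W\<close>. In the
  first step the linear system is empty, its only solution is the vector of
  dimension 0, and the residual is the first column itself.
\<close>

primrec deim_indices :: "real mat \<Rightarrow> nat \<Rightarrow> nat list" where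
  "deim_indices W 0 = []"
| "deim_indices W (Suc l) =
     (let \<phi> = deim_indices W l;
          c = (THE c. c \<in> carrier_vec l \<and>
                (\<forall>s<l. (\<Sum>j<l. col W j $ (\<phi> ! s) * c $ j) = col W l $ (\<phi> ! s)));
          r = vec (dim_row W) (\<lambda>i. col W l $ i - (\<Sum>j<l. c $ j * col W j $ i))
      in \<phi> @ [argmax_abs_vec r])"

definition deim :: "real mat \<Rightarrow> real mat" where
  "deim W = masking_mat (dim_row W) (deim_indices W (dim_col W))"


definition teim_term :: "real mat \<Rightarrow> real mat \<Rightarrow> nat \<Rightarrow> real mat" where
  "teim_term U\<^sub>1 U\<^sub>2 t =
     (let u = col U\<^sub>1 (t div dim_col U\<^sub>2); v = col U\<^sub>2 (t mod dim_col U\<^sub>2)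
      in mat (dim_row U\<^sub>1) (dim_row U\<^sub>2) (\<lambda>(i, j). u $ i * v $ j))"

text \<open>
  \<open>teim_indices U\<^sub>1 U\<^sub>2 t\<close> lists the first \<open>t\<close> selected (row, column) pairs; the first
  step is again the case of an empty linear system.
\<close>

primrec teim_indices :: "real mat \<Rightarrow> real mat \<Rightarrow> nat \<Rightarrow> (nat \<times> nat) list" where
  "teim_indices U\<^sub>1 U\<^sub>2 0 = []"
| "teim_indices U\<^sub>1 U\<^sub>2 (Suc t) =
     (let pq = teim_indices U\<^sub>1 U\<^sub>2 t;
          B = teim_term U\<^sub>1 U\<^sub>2;
          c = (THE c. c \<in> carrier_vec t \<and>
                (\<forall>s<t. (\<Sum>s'<t. B s' $$ (pq ! s) * c $ s') = B t $$ (pq ! s)));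
          R = mat (dim_row U\<^sub>1) (dim_row U\<^sub>2)
                (\<lambda>(i, j). B t $$ (i, j) - (\<Sum>s'<t. c $ s' * B s' $$ (i, j)))
      in pq @ [argmax_abs_mat R])"

definition teim :: "real mat \<Rightarrow> real mat \<Rightarrow> real mat \<times> real mat" where
  "teim U\<^sub>1 U\<^sub>2 =
     (let pq = teim_indices U\<^sub>1 U\<^sub>2 (dim_col U\<^sub>1 * dim_col U\<^sub>2)
      in (masking_mat (dim_row U\<^sub>1) (map fst pq), masking_mat (dim_row U\<^sub>2) (map snd pq)))"

end

theory Submission
  imports Defs "Jordan_Normal_Form.DL_Rank"
begin

text \<open>
  At step \<open>k * m\<^sub>2 + l\<close> the TEIM residual is the tensor product of the \<open>k\<close>-th DEIM residual
  of \<open>U\<^sub>1\<close> and the \<open>l\<close>-th DEIM residual of \<open>U\<^sub>2\<close>: this product lies in the right affine space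
  and vanishes at all earlier positions, and the interpolation problem has only one solution.
  The first maximal entry of a nonzero tensor product, in column-major order, sits at the pair
  of the first maximal entries of the two factors.
\<close>

section \<open>Interpolation systems and their residuals\<close>

text \<open>Solvability for every right-hand side \<open>g\<close> expresses invertibility of the
  matrix of values, and the induction on \<open>t\<close> relies on \<open>g\<close> being
  arbitrary. The point type is left open: indices for DEIM, index pairs for TEIM.\<close>

definition unisolvent :: "(nat \<Rightarrow> 'p \<Rightarrow> real) \<Rightarrow> (nat \<Rightarrow> 'p) \<Rightarrow> nat \<Rightarrow> bool" where
  "unisolvent f x t \<longleftrightarrow>
     (\<forall>g. \<exists>!c. c \<in> carrier_vec t \<and> (\<forall>s<t. (\<Sum>j<t. f j (x s) * c $ j) = g s))"

text \<open>The choice of \<open>c\<close> repeats the one in both algorithms, so that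
  \<open>deim_indices\<close> and \<open>teim_indices\<close> unfold to the same notion.\<close>

definition interp_residual :: "(nat \<Rightarrow> 'p \<Rightarrow> real) \<Rightarrow> (nat \<Rightarrow> 'p) \<Rightarrow> nat \<Rightarrow> 'p \<Rightarrow> real" where
  "interp_residual f x t =
     (let c = (THE c. c \<in> carrier_vec t \<and> (\<forall>s<t. (\<Sum>j<t. f j (x s) * c $ j) = f t (x s)))
      in (\<lambda>p. f t p - (\<Sum>j<t. c $ j * f j p)))"

text \<open>Serves to exchange the list of positions selected so far for a pivot function on all of
  \<open>nat\<close>.\<close>

lemma interp_residual_cong:
  assumes "\<And>s. s < t \<Longrightarrow> x s = y s"
  shows "interp_residual f x t = interp_residual f y t"
proof -
  have "(\<forall>s<t. (\<Sum>j<t. f j (x s) * c $ j) = f t (x s)) \<longleftrightarrow>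
      (\<forall>s<t. (\<Sum>j<t. f j (y s) * c $ j) = f t (y s))" for c
    using assms by (intro all_cong) simp
  then show ?thesis
    by (simp only: interp_residual_def)
qed

lemma unisolvent_0: "unisolvent f x 0"
proof -
  have "\<exists>!c :: real vec. c \<in> carrier_vec 0"
    by (rule ex1I[of _ "0\<^sub>v 0"]) auto
  then show ?thesis
    by (simp add: unisolvent_def)
qed

lemma interp_residual_eqI:
  assumes uni: "unisolvent f x t"
    and zero: "\<And>s. s < t \<Longrightarrow> f t (x s) - (\<Sum>j<t. c j * f j (x s)) = 0"
  shows "interp_residual f x t p = f t p - (\<Sum>j<t. c j * f j p)"
proof -
  let ?P = "\<lambda>c. c \<in> carrier_vec t \<and> (\<forall>s<t. (\<Sum>j<t. f j (x s) * c $ j) = f t (x s))"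
  have ex1: "\<exists>!c. ?P c"
    by (rule uni[unfolded unisolvent_def, THEN spec])
  have "?P (vec t c)"
    using zero by (auto simp: mult.commute)
  with ex1 have "(THE c. ?P c) = vec t c"
    by (rule the1_equality)
  then show ?thesis
    by (simp add: interp_residual_def)
qed

lemma interp_residualE:
  assumes "unisolvent f x t"
  obtains c where "\<And>p. interp_residual f x t p = f t p - (\<Sum>j<t. c j * f j p)"
    and "\<And>s. s < t \<Longrightarrow> interp_residual f x t (x s) = 0"
proof -
  obtain v where "v \<in> carrier_vec t" "\<forall>s<t. (\<Sum>j<t. f j (x s) * v $ j) = f t (x s)"
    using ex1_implies_ex[OF assms[unfolded unisolvent_def, THEN spec, of "\<lambda>s. f t (x s)"]]
    by (elim exE conjE)
  then have z: "\<And>s. s < t \<Longrightarrow> f t (x s) - (\<Sum>j<t. v $ j * f j (x s)) = 0"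
    by (simp add: mult.commute)
  note eq = interp_residual_eqI[OF assms z]
  show thesis
    by (rule that[OF eq]) (simp_all add: eq z)
qed

text \<open>Elimination: if the last function is replaced by the residual, the new column vanishes
  in the first \<open>t\<close> rows. The system is then block triangular, with an invertible
  leading block and a nonzero last diagonal entry.\<close>

lemma unisolvent_Suc:
  assumes uni: "unisolvent f x t" and nz: "interp_residual f x t (x t) \<noteq> 0"
  shows "unisolvent f x (Suc t)"
  unfolding unisolvent_def
proof (intro allI)
  fix g :: "nat \<Rightarrow> real"
  let ?r = "interp_residual f x t"
  obtain c where c: "\<And>p. ?r p = f t p - (\<Sum>j<t. c j * f j p)"
    and rz: "\<And>s. s < t \<Longrightarrow> ?r (x s) = 0"
    using uni by (rule interp_residualE) blast
  obtain d where d: "d \<in> carrier_vec t" "\<forall>s<t. (\<Sum>j<t. f j (x s) * d $ j) = g s"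
    and dun: "\<And>e. e \<in> carrier_vec t \<Longrightarrow> \<forall>s<t. (\<Sum>j<t. f j (x s) * e $ j) = g s \<Longrightarrow> e = d"
    using uni unfolding unisolvent_def by metis
  \<comment> \<open>The first \<open>t\<close> equations force \<open>d\<close>; \<alpha> is the
    multiple of the residual that repairs the remaining defect at \<open>x t\<close>.\<close>
  define \<alpha> where "\<alpha> = (g t - (\<Sum>j<t. f j (x t) * d $ j)) / ?r (x t)"
  let ?e = "vec (Suc t) (\<lambda>j. if j = t then \<alpha> else d $ j - \<alpha> * c j)"
  \<comment> \<open>The same sum in the basis of the first \<open>t\<close> functions and the
    residual.\<close>
  have expand: "(\<Sum>j<Suc t. f j p * e $ j) = (\<Sum>j<t. f j p * (e $ j + e $ t * c j)) + e $ t * ?r p"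
    for p e
    by (simp add: c algebra_simps sum.distrib sum_distrib_left)
  show "\<exists>!e. e \<in> carrier_vec (Suc t) \<and> (\<forall>s<Suc t. (\<Sum>j<Suc t. f j (x s) * e $ j) = g s)"
  proof (intro ex1I[of _ ?e] conjI allI impI)
    show "?e \<in> carrier_vec (Suc t)" by simp
    fix s assume "s < Suc t"
    then show "(\<Sum>j<Suc t. f j (x s) * ?e $ j) = g s"
      unfolding expand using d(2) rz nz by (cases "s = t") (auto simp: \<alpha>_def)
  next
    fix e assume e: "e \<in> carrier_vec (Suc t) \<and> (\<forall>s<Suc t. (\<Sum>j<Suc t. f j (x s) * e $ j) = g s)"
    have sys: "(\<Sum>j<t. f j (x s) * (e $ j + e $ t * c j)) + e $ t * ?r (x s) = g s" if "s < Suc t" for s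
      using e that unfolding expand by blast
    \<comment> \<open>The residual vanishes at the first \<open>t\<close> points, so the shifted
      coefficients solve the smaller system, whose solution is unique.\<close>
    have "vec t (\<lambda>j. e $ j + e $ t * c j) = d"
    proof (rule dun)
      show "\<forall>s<t. (\<Sum>j<t. f j (x s) * vec t (\<lambda>j. e $ j + e $ t * c j) $ j) = g s"
      proof (intro allI impI)
        fix s assume "s < t"
        then show "(\<Sum>j<t. f j (x s) * vec t (\<lambda>j. e $ j + e $ t * c j) $ j) = g s"
          using sys[of s] rz[of s] by simp
      qed
    qed simp
    then have ed: "d $ j = e $ j + e $ t * c j" if "j < t" for j
      using that by auto
    have "e $ t = \<alpha>"
      using sys[of t] nz ed by (simp add: \<alpha>_def field_simps)
    then show "e = ?e"
      using e ed by (intro eq_vecI) (auto simp: less_Suc_eq)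
  qed
qed

text \<open>Extending the coefficients by zero beyond \<open>t\<close> makes one family
  \<open>a\<close> valid for every bound \<open>N\<close>: all columns for linear independence, and
  bounds adapted to the double sum for TEIM.\<close>

lemma interp_residual_combination:
  assumes "unisolvent f x t"
  obtains a where "\<And>N p. t < N \<Longrightarrow> interp_residual f x t p = (\<Sum>j<N. a j * f j p)"
    and "a t = 1" and "\<And>j. t < j \<Longrightarrow> a j = 0"
proof -
  obtain c where c: "\<And>p. interp_residual f x t p = f t p - (\<Sum>j<t. c j * f j p)"
    using assms by (rule interp_residualE) blast
  define a where "a j = (if j < t then - c j else if j = t then 1 else 0)" for j
  have "interp_residual f x t p = (\<Sum>j<N. a j * f j p)" if "t < N" for N p
  proof -
    have "(\<Sum>j<N. a j * f j p) = (\<Sum>j<Suc t. a j * f j p)"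
      using that by (intro sum.mono_neutral_right) (auto simp: a_def)
    also have "\<dots> = interp_residual f x t p"
      by (simp add: c a_def sum_negf)
    finally show ?thesis ..
  qed
  then show thesis
    by (rule that) (auto simp: a_def)
qed

text \<open>This is how a guessed residual is recognized: unisolvence leaves only one candidate with
  leading coefficient 1 that vanishes at the earlier points.\<close>

lemma interp_residual_eq_combination:
  assumes "unisolvent f x t" and "a t = 1"
    and "\<And>s. s < t \<Longrightarrow> (\<Sum>j<Suc t. a j * f j (x s)) = 0"
  shows "interp_residual f x t p = (\<Sum>j<Suc t. a j * f j p)"
  using interp_residual_eqI[of f x t "\<lambda>j. - a j" p] assms
  by (simp add: sum_negf add.commute)

subsection \<open>First maximal entries\<close>

definition is_max_abs_index :: "real vec \<Rightarrow> nat \<Rightarrow> bool" where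
  "is_max_abs_index v i \<longleftrightarrow> i < dim_vec v \<and> (\<forall>i'<dim_vec v. \<bar>v $ i'\<bar> \<le> \<bar>v $ i\<bar>)"

lemma argmax_abs_vec_eq: "argmax_abs_vec v = (LEAST i. is_max_abs_index v i)"
  by (simp add: argmax_abs_vec_def is_max_abs_index_def)

lemma is_max_abs_index_argmax:
  assumes "0 < dim_vec v"
  shows "is_max_abs_index v (argmax_abs_vec v)"
proof -
  let ?A = "(\<lambda>i. \<bar>v $ i\<bar>) ` {..<dim_vec v}"
  have "Max ?A \<in> ?A"
    using assms by (intro Max_in) auto
  then obtain i where i: "i < dim_vec v" "\<bar>v $ i\<bar> = Max ?A"
    by auto
  have "\<bar>v $ i'\<bar> \<le> \<bar>v $ i\<bar>" if "i' < dim_vec v" for i'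
    unfolding i(2) using that by (intro Max_ge) auto
  with i(1) have "is_max_abs_index v i"
    by (simp add: is_max_abs_index_def)
  then show ?thesis
    unfolding argmax_abs_vec_eq by (rule LeastI)
qed

lemma is_max_abs_index_nonzero:
  assumes "is_max_abs_index v i" "v \<noteq> 0\<^sub>v (dim_vec v)"
  shows "v $ i \<noteq> 0"
  using assms by (fastforce simp: is_max_abs_index_def)

text \<open>Absolute values multiply, so maxima of the factors give a maximum of the product.
  Conversely, the maximum is positive because both factors are nonzero; fixing one index at a
  maximal position lets the positive common factor be cancelled.\<close>

lemma is_max_abs_pos_tensor:
  fixes v w :: "real vec"
  assumes v: "v \<noteq> 0\<^sub>v (dim_vec v)" and w: "w \<noteq> 0\<^sub>v (dim_vec w)"
  defines "A \<equiv> mat (dim_vec v) (dim_vec w) (\<lambda>(i, j). v $ i * w $ j)"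
  shows "is_max_abs_pos A i j \<longleftrightarrow> is_max_abs_index v i \<and> is_max_abs_index w j"
proof
  assume "is_max_abs_index v i \<and> is_max_abs_index w j"
  then show "is_max_abs_pos A i j"
    by (auto simp: is_max_abs_pos_def is_max_abs_index_def A_def abs_mult intro!: mult_mono)
next
  assume "is_max_abs_pos A i j"
  then have ij: "i < dim_vec v" "j < dim_vec w"
    and le: "\<And>i' j'. i' < dim_vec v \<Longrightarrow> j' < dim_vec w \<Longrightarrow>
      \<bar>v $ i'\<bar> * \<bar>w $ j'\<bar> \<le> \<bar>v $ i\<bar> * \<bar>w $ j\<bar>"
    by (auto simp: is_max_abs_pos_def A_def abs_mult)
  obtain i0 j0 where "i0 < dim_vec v" "v $ i0 \<noteq> 0" "j0 < dim_vec w" "w $ j0 \<noteq> 0"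
    using v w by (metis eq_vecI index_zero_vec)
  then have "0 < \<bar>v $ i\<bar> * \<bar>w $ j\<bar>"
    using le[of i0 j0] by (smt (verit) mult_pos_pos)
  then have "0 < \<bar>v $ i\<bar>" "0 < \<bar>w $ j\<bar>"
    by (auto simp: zero_less_mult_iff)
  with ij le[of _ j] le[of i] show "is_max_abs_index v i \<and> is_max_abs_index w j"
    by (simp add: is_max_abs_index_def)
qed

text \<open>The maximal positions form a product set, so the least column and the least row in that
  column are minimized independently.\<close>

lemma argmax_abs_mat_tensor:
  fixes v w :: "real vec"
  assumes v: "v \<noteq> 0\<^sub>v (dim_vec v)" and w: "w \<noteq> 0\<^sub>v (dim_vec w)"
  shows "argmax_abs_mat (mat (dim_vec v) (dim_vec w) (\<lambda>(i, j). v $ i * w $ j)) =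
    (argmax_abs_vec v, argmax_abs_vec w)"
proof -
  have "0 < dim_vec v" "0 < dim_vec w"
    using v w by (auto intro!: Nat.gr0I)
  then have m: "is_max_abs_index v (argmax_abs_vec v)" "is_max_abs_index w (argmax_abs_vec w)"
    by (simp_all add: is_max_abs_index_argmax)
  \<comment> \<open>Projecting the product set to its columns loses nothing, since \<open>v\<close>
    has a maximal index.\<close>
  have "(\<exists>i. is_max_abs_index v i \<and> is_max_abs_index w j) = is_max_abs_index w j" for j
    using m(1) by blast
  with m(2) show ?thesis
    by (simp add: argmax_abs_mat_def is_max_abs_pos_tensor[OF v w] Let_def
        flip: argmax_abs_vec_eq)
qed

subsection \<open>DEIM\<close>

text \<open>Passes from sets of vectors to coefficients: a relation with a nonzero coefficient is a
  nonzero kernel vector, which makes the set of distinct columns dependent.\<close>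

lemma lin_indep_colsD:
  assumes U: "lin_indep_cols U"
    and z: "\<And>i. i < dim_row U \<Longrightarrow> (\<Sum>j<dim_col U. a j * col U j $ i) = 0"
    and l: "l < dim_col U"
  shows "a l = 0"
proof (rule ccontr)
  assume "a l \<noteq> 0"
  have "U *\<^sub>v vec (dim_col U) a = 0\<^sub>v (dim_row U)"
    using z by (intro eq_vecI) (auto simp: scalar_prod_def mult.commute lessThan_atLeast0)
  moreover have "vec (dim_col U) a \<noteq> 0\<^sub>v (dim_col U)"
    using \<open>a l \<noteq> 0\<close> l by (metis index_vec index_zero_vec(1))
  ultimately have "LinearCombinations.module.lin_dep class_ring
         (module_vec TYPE(real) (dim_row U)) (set (cols U))"
    using U by (intro vec_space.lin_depI[of U "dim_row U" "dim_col U" "vec (dim_col U) a"])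
      (auto simp: lin_indep_cols_def)
  with U show False
    by (simp add: lin_indep_cols_def)
qed

text \<open>A function on \<open>nat\<close> replaces the lists of growing length, as entries once
  selected never change.\<close>

definition deim_pivot :: "real mat \<Rightarrow> nat \<Rightarrow> nat" where
  "deim_pivot W l = deim_indices W (Suc l) ! l"

definition deim_residual :: "real mat \<Rightarrow> nat \<Rightarrow> nat \<Rightarrow> real" where
  "deim_residual W l = interp_residual (\<lambda>j i. col W j $ i) (deim_pivot W) l"

lemma length_deim_indices [simp]: "length (deim_indices W l) = l"
  by (induction l) (auto simp: Let_def)

lemma deim_indices_eq: "deim_indices W l = map (deim_pivot W) [0..<l]"
proof (induction l)
  case (Suc l)
  have "deim_indices W (Suc l) = deim_indices W l @ [deim_pivot W l]"
    by (simp add: Let_def nth_append deim_pivot_def)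
  then show ?case
    unfolding Suc.IH by simp
qed simp

text \<open>Only the first \<open>l\<close> list entries enter the residual, so the recursion on
  lists becomes one on pivots.\<close>

lemma deim_pivot_eq: "deim_pivot W l = argmax_abs_vec (vec (dim_row W) (deim_residual W l))"
proof -
  have "deim_pivot W l =
      argmax_abs_vec (vec (dim_row W) (interp_residual (\<lambda>j i. col W j $ i) ((!) (deim_indices W l)) l))"
    by (simp add: deim_pivot_def interp_residual_def Let_def nth_append)
  also have "interp_residual (\<lambda>j i. col W j $ i) ((!) (deim_indices W l)) l = deim_residual W l"
    unfolding deim_residual_def
    by (rule interp_residual_cong) (simp add: deim_indices_eq)
  finally show ?thesis .
qed

text \<open>Column \<open>l\<close> enters the residual with coefficient 1, so a zero residual would
  be a nontrivial relation between the columns.\<close>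

lemma deim_residual_nonzero:
  assumes "lin_indep_cols W" "l < dim_col W"
    and uni: "unisolvent (\<lambda>j i. col W j $ i) (deim_pivot W) l"
  shows "vec (dim_row W) (deim_residual W l) \<noteq> 0\<^sub>v (dim_row W)"
proof
  assume z: "vec (dim_row W) (deim_residual W l) = 0\<^sub>v (dim_row W)"
  obtain a where a: "\<And>N i. l < N \<Longrightarrow> deim_residual W l i = (\<Sum>j<N. a j * col W j $ i)"
    and "a l = 1"
    using interp_residual_combination[OF uni] unfolding deim_residual_def by metis
  have "(\<Sum>j<dim_col W. a j * col W j $ i) = 0" if "i < dim_row W" for i
    using a[OF assms(2), of i] z that by (metis index_vec index_zero_vec(1))
  then have "a l = 0"
    by (rule lin_indep_colsD[OF assms(1) _ assms(2)])
  with \<open>a l = 1\<close> show False by simp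
qed

lemma deim_residual_pivot:
  assumes "vec (dim_row W) (deim_residual W l) \<noteq> 0\<^sub>v (dim_row W)"
  shows "deim_pivot W l < dim_row W" and "deim_residual W l (deim_pivot W l) \<noteq> 0"
proof -
  have m: "is_max_abs_index (vec (dim_row W) (deim_residual W l)) (deim_pivot W l)"
    using assms unfolding deim_pivot_eq by (intro is_max_abs_index_argmax) (auto intro!: Nat.gr0I)
  then show lt: "deim_pivot W l < dim_row W"
    by (simp add: is_max_abs_index_def)
  show "deim_residual W l (deim_pivot W l) \<noteq> 0"
    using is_max_abs_index_nonzero[OF m] assms lt by simp
qed

text \<open>By induction: independence makes the residual nonzero, and its largest entry is a
  nonzero pivot that carries unisolvence one step further.\<close>

lemma deim_unisolvent:
  assumes "lin_indep_cols W" "l \<le> dim_col W"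
  shows "unisolvent (\<lambda>j i. col W j $ i) (deim_pivot W) l"
  using assms(2)
proof (induction l)
  case 0
  show ?case by (rule unisolvent_0)
next
  case (Suc l)
  then have uni: "unisolvent (\<lambda>j i. col W j $ i) (deim_pivot W) l" by simp
  then show ?case
    using deim_residual_pivot(2)[OF deim_residual_nonzero[OF assms(1) _ uni]] Suc.prems
    by (intro unisolvent_Suc) (auto simp: deim_residual_def)
qed

subsection \<open>TEIM\<close>

text \<open>The predicted selection, built from DEIM alone, so that unisolvence can be shown at
  these positions before the output of TEIM is known.\<close>

definition teim_pivot :: "real mat \<Rightarrow> real mat \<Rightarrow> nat \<Rightarrow> nat \<times> nat" where
  "teim_pivot U V t = (deim_pivot U (t div dim_col V), deim_pivot V (t mod dim_col V))"

text \<open>The range splits into \<open>k\<close> blocks of length \<open>m\<close>; on each block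
  the quotient is constant and the remainder runs through all values below \<open>m\<close>.\<close>

lemma sum_div_mod:
  fixes g :: "nat \<Rightarrow> nat \<Rightarrow> 'a :: comm_monoid_add"
  shows "(\<Sum>s<k * m. g (s div m) (s mod m)) = (\<Sum>a<k. \<Sum>b<m. g a b)"
proof -
  have "(\<Sum>s = a * m..<a * m + m. g (s div m) (s mod m)) = (\<Sum>b<m. g a b)" for a
    using sum.shift_bounds_nat_ivl[of "\<lambda>s. g (s div m) (s mod m)" 0 "a * m" m]
    by (simp add: add.commute lessThan_atLeast0)
  then show ?thesis
    by (simp flip: sum.nat_group)
qed

text \<open>The product of the two DEIM residuals is a combination of the terms up to
  \<open>t\<close> with leading coefficient 1, and it vanishes at the earlier pivot pairs;
  unisolvence identifies it with the residual. At its own pivot pair both factors are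
  nonzero.\<close>

lemma
  assumes U: "lin_indep_cols U" and V: "lin_indep_cols V"
    and t: "t < dim_col U * dim_col V"
    and uni: "unisolvent (\<lambda>s p. teim_term U V s $$ p) (teim_pivot U V) t"
  shows teim_residual: "\<And>i j. i < dim_row U \<Longrightarrow> j < dim_row V \<Longrightarrow>
      interp_residual (\<lambda>s p. teim_term U V s $$ p) (teim_pivot U V) t (i, j) =
      deim_residual U (t div dim_col V) i * deim_residual V (t mod dim_col V) j"
    and teim_residual_pivot:
      "interp_residual (\<lambda>s p. teim_term U V s $$ p) (teim_pivot U V) t (teim_pivot U V t) \<noteq> 0"
proof -
  let ?m = "dim_col V" and ?F = "\<lambda>s p. teim_term U V s $$ p"
  let ?k = "t div ?m" and ?l = "t mod ?m"
  have "0 < ?m" using t by (auto intro!: Nat.gr0I)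
  then have l: "?l < ?m" and k: "?k < dim_col U"
    using t by (auto simp: less_mult_imp_div_less)
  note uniU = deim_unisolvent[OF U] and uniV = deim_unisolvent[OF V]
  have pivU: "deim_pivot U a < dim_row U" "deim_residual U a (deim_pivot U a) \<noteq> 0"
    if "a < dim_col U" for a
    using deim_residual_pivot[OF deim_residual_nonzero[OF U that uniU]] that by simp_all
  have pivV: "deim_pivot V b < dim_row V" "deim_residual V b (deim_pivot V b) \<noteq> 0"
    if "b < ?m" for b
    using deim_residual_pivot[OF deim_residual_nonzero[OF V that uniV]] that by simp_all
  obtain a where a: "\<And>N i. ?k < N \<Longrightarrow> deim_residual U ?k i = (\<Sum>j<N. a j * col U j $ i)"
      "a ?k = 1"
    by (rule interp_residual_combination[OF uniU[OF less_imp_le[OF k]], folded deim_residual_def])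
      blast
  obtain b where b: "\<And>N i. ?l < N \<Longrightarrow> deim_residual V ?l i = (\<Sum>j<N. b j * col V j $ i)"
      "b ?l = 1" "\<And>j. ?l < j \<Longrightarrow> b j = 0"
    by (rule interp_residual_combination[OF uniV[OF less_imp_le[OF l]], folded deim_residual_def])
      blast
  have tlt: "t < Suc ?k * ?m"
    using \<open>0 < ?m\<close> by (metis dividend_less_div_times mult_Suc)
  have prod: "deim_residual U ?k i * deim_residual V ?l j =
      (\<Sum>s<Suc t. (a (s div ?m) * b (s mod ?m)) * ?F s (i, j))"
    if ij: "i < dim_row U" "j < dim_row V" for i j
  proof -
    \<comment> \<open>The inner sum takes all \<open>?m\<close> columns rather than stopping at
      \<open>?l\<close>, so that the double sum runs over an initial segment of the
      iterations.\<close>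
    have "deim_residual U ?k i * deim_residual V ?l j =
        (\<Sum>x<Suc ?k. \<Sum>y<?m. (a x * col U x $ i) * (b y * col V y $ j))"
      by (simp only: a(1)[OF lessI] b(1)[OF l] sum_product)
    also have "\<dots> = (\<Sum>s<Suc ?k * ?m. (a (s div ?m) * b (s mod ?m)) * ?F s (i, j))"
      unfolding sum_div_mod[symmetric] using ij
      by (intro sum.cong) (simp_all add: teim_term_def)
    \<comment> \<open>Block \<open>?k\<close> may extend past \<open>t\<close>. The excess indices
      have quotient \<open>?k\<close> and remainder above \<open>?l\<close>, where \<open>b\<close>
      is zero.\<close>
    also have "\<dots> = (\<Sum>s<Suc t. (a (s div ?m) * b (s mod ?m)) * ?F s (i, j))"
    proof (rule sum.mono_neutral_right)
      show "\<forall>s\<in>{..<Suc ?k * ?m} - {..<Suc t}. a (s div ?m) * b (s mod ?m) * ?F s (i, j) = 0"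
      proof
        fix s assume s: "s \<in> {..<Suc ?k * ?m} - {..<Suc t}"
        then have "s div ?m < Suc ?k" "?k \<le> s div ?m"
          by (auto simp: less_mult_imp_div_less intro: div_le_mono simp del: mult_Suc)
        then have "s div ?m = ?k" by simp
        then have "s = ?k * ?m + s mod ?m"
          by (metis div_mult_mod_eq)
        moreover have "t = ?k * ?m + ?l" by simp
        moreover have "t < s" using s by simp
        ultimately have "?l < s mod ?m" by linarith
        then show "a (s div ?m) * b (s mod ?m) * ?F s (i, j) = 0"
          by (simp add: b(3))
      qed
    qed (use tlt in auto)
    finally show ?thesis .
  qed
  have zeroU: "deim_residual U ?k (deim_pivot U x) = 0" if "x < ?k" for x
    by (rule interp_residualE[OF uniU[OF less_imp_le[OF k]], folded deim_residual_def])
      (use that in blast)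
  have zeroV: "deim_residual V ?l (deim_pivot V y) = 0" if "y < ?l" for y
    by (rule interp_residualE[OF uniV[OF less_imp_le[OF l]], folded deim_residual_def])
      (use that in blast)
  have zero: "(\<Sum>s'<Suc t. (a (s' div ?m) * b (s' mod ?m)) * ?F s' (teim_pivot U V s)) = 0"
    if s: "s < t" for s
  proof -
    have lt: "s div ?m < dim_col U" "s mod ?m < ?m"
      using s t \<open>0 < ?m\<close> by (auto simp: less_mult_imp_div_less)
    \<comment> \<open>The iterations are ordered lexicographically, so an earlier pair has a smaller
      quotient or a smaller remainder, and the corresponding factor vanishes there.\<close>
    have "s div ?m < ?k \<or> s mod ?m < ?l"
      using s by (metis div_le_mono div_mult_mod_eq le_neq_implies_less less_imp_le
          nat_add_left_cancel_less)
    then have "deim_residual U ?k (deim_pivot U (s div ?m)) *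
        deim_residual V ?l (deim_pivot V (s mod ?m)) = 0"
      using zeroU zeroV by auto
    then show ?thesis
      \<comment> \<open>The expansion \<open>prod\<close> covers only positions inside the matrix,
        hence the bounds on the pivots.\<close>
      using prod[OF pivU(1)[OF lt(1)] pivV(1)[OF lt(2)]] by (simp add: teim_pivot_def)
  qed
  show res: "interp_residual ?F (teim_pivot U V) t (i, j) =
      deim_residual U ?k i * deim_residual V ?l j"
    if "i < dim_row U" "j < dim_row V" for i j
    unfolding prod[OF that]
    by (rule interp_residual_eq_combination[OF uni]) (use a(2) b(2) zero in auto)
  show "interp_residual ?F (teim_pivot U V) t (teim_pivot U V t) \<noteq> 0"
    using pivU[OF k] pivV[OF l] by (simp add: teim_pivot_def[of U V t] res)
qed

lemma teim_unisolvent: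
  assumes "lin_indep_cols U" "lin_indep_cols V" "t \<le> dim_col U * dim_col V"
  shows "unisolvent (\<lambda>s p. teim_term U V s $$ p) (teim_pivot U V) t"
  using assms(3)
proof (induction t)
  case 0
  show ?case by (rule unisolvent_0)
next
  case (Suc t)
  then show ?case
    by (intro unisolvent_Suc teim_residual_pivot assms) auto
qed

text \<open>By induction on \<open>t\<close>: the earlier selections agree with
  \<open>teim_pivot\<close>, so the matrix to be maximized is a tensor product of two nonzero DEIM
  residuals, and its first maximal position is the pair of DEIM pivots.\<close>

lemma teim_indices_eq:
  assumes U: "lin_indep_cols U" and V: "lin_indep_cols V" and "t \<le> dim_col U * dim_col V"
  shows "teim_indices U V t = map (teim_pivot U V) [0..<t]"
  using assms(3)
proof (induction t)
  case (Suc t)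
  let ?F = "\<lambda>s p. teim_term U V s $$ p" and ?m = "dim_col V"
  let ?v = "vec (dim_row U) (deim_residual U (t div ?m))"
  let ?w = "vec (dim_row V) (deim_residual V (t mod ?m))"
  have t: "t < dim_col U * ?m" using Suc.prems by simp
  then have "0 < ?m" by (auto intro!: Nat.gr0I)
  then have kl: "t div ?m < dim_col U" "t mod ?m < ?m"
    using t by (auto simp: less_mult_imp_div_less)
  have nz: "?v \<noteq> 0\<^sub>v (dim_vec ?v)" "?w \<noteq> 0\<^sub>v (dim_vec ?w)"
    using deim_residual_nonzero[OF U kl(1) deim_unisolvent[OF U]]
      deim_residual_nonzero[OF V kl(2) deim_unisolvent[OF V]] kl by simp_all
  have IH: "teim_indices U V t = map (teim_pivot U V) [0..<t]"
    using Suc by simp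
  have "interp_residual ?F ((!) (teim_indices U V t)) t = interp_residual ?F (teim_pivot U V) t"
    by (rule interp_residual_cong) (simp add: IH)
  then have "mat (dim_row U) (dim_row V) (interp_residual ?F ((!) (teim_indices U V t)) t) =
      mat (dim_vec ?v) (dim_vec ?w) (\<lambda>(i, j). ?v $ i * ?w $ j)"
    using t teim_residual[OF U V t teim_unisolvent[OF U V]]
    by (intro eq_matI) auto
  moreover have "teim_indices U V (Suc t) = teim_indices U V t @
      [argmax_abs_mat (mat (dim_row U) (dim_row V) (interp_residual ?F ((!) (teim_indices U V t)) t))]"
    by (simp add: interp_residual_def Let_def case_prod_unfold)
  ultimately show ?case
    using argmax_abs_mat_tensor[OF nz]
    by (simp add: IH teim_pivot_def deim_pivot_eq del: teim_indices.simps)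
qed simp

section \<open>Comparison of the masking operators\<close>

lemma row_masking_mat: "i < length xs \<Longrightarrow> row (masking_mat n xs) i = unit_vec n (xs ! i)"
  by (simp add: masking_mat_def)

theorem theorem2:
  fixes n\<^sub>1 n\<^sub>2 m\<^sub>1 m\<^sub>2 :: nat
    and U\<^sub>1 U\<^sub>2 P\<^sub>1 P\<^sub>2 P\<^sub>3 P\<^sub>4 P\<^sub>5 P\<^sub>6 :: "real mat"
  assumes "0 < m\<^sub>1" "m\<^sub>1 \<le> n\<^sub>1" "0 < m\<^sub>2" "m\<^sub>2 \<le> n\<^sub>2"
    and "U\<^sub>1 \<in> carrier_mat n\<^sub>1 m\<^sub>1" "lin_indep_cols U\<^sub>1"
    and "U\<^sub>2 \<in> carrier_mat n\<^sub>2 m\<^sub>2" "lin_indep_cols U\<^sub>2"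
    and "(P\<^sub>1, P\<^sub>2) = teim U\<^sub>1 U\<^sub>2"
    and "P\<^sub>3 \<in> carrier_mat m\<^sub>1 n\<^sub>1"
    and "\<And>i. i < m\<^sub>1 \<Longrightarrow> col (transpose_mat P\<^sub>3) i = col (transpose_mat P\<^sub>1) (i * m\<^sub>2)"
    and "P\<^sub>4 \<in> carrier_mat m\<^sub>2 n\<^sub>2"
    and "\<And>j. j < m\<^sub>2 \<Longrightarrow> col (transpose_mat P\<^sub>4) j = col (transpose_mat P\<^sub>2) j"
    and "P\<^sub>5 = deim U\<^sub>1"
    and "P\<^sub>6 = deim U\<^sub>2"
  shows "P\<^sub>3 = P\<^sub>5 \<and> P\<^sub>4 = P\<^sub>6"
proof -
  have dims [simp]: "dim_row U\<^sub>1 = n\<^sub>1" "dim_col U\<^sub>1 = m\<^sub>1" "dim_row U\<^sub>2 = n\<^sub>2" "dim_col U\<^sub>2 = m\<^sub>2"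
    "dim_row P\<^sub>3 = m\<^sub>1" "dim_col P\<^sub>3 = n\<^sub>1" "dim_row P\<^sub>4 = m\<^sub>2" "dim_col P\<^sub>4 = n\<^sub>2"
    using assms by auto
  have P1: "P\<^sub>1 = masking_mat n\<^sub>1 (map (fst \<circ> teim_pivot U\<^sub>1 U\<^sub>2) [0..<m\<^sub>1 * m\<^sub>2])"
    and P2: "P\<^sub>2 = masking_mat n\<^sub>2 (map (snd \<circ> teim_pivot U\<^sub>1 U\<^sub>2) [0..<m\<^sub>1 * m\<^sub>2])"
    using assms(9) teim_indices_eq[OF assms(6,8)] by (simp_all add: teim_def Let_def)
  have P5: "P\<^sub>5 = masking_mat n\<^sub>1 (map (deim_pivot U\<^sub>1) [0..<m\<^sub>1])"
    and P6: "P\<^sub>6 = masking_mat n\<^sub>2 (map (deim_pivot U\<^sub>2) [0..<m\<^sub>2])"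
    by (simp_all add: assms(14,15) deim_def deim_indices_eq)
  have lt1: "i * m\<^sub>2 < m\<^sub>1 * m\<^sub>2" if "i < m\<^sub>1" for i
    using that assms(3) by simp
  have lt2: "j < m\<^sub>1 * m\<^sub>2" if "j < m\<^sub>2" for j
    using that assms(1) by (metis One_nat_def Suc_leI less_le_trans mult_le_mono1 nat_mult_1)
  have d1: "dim_row P\<^sub>1 = m\<^sub>1 * m\<^sub>2" "dim_row P\<^sub>2 = m\<^sub>1 * m\<^sub>2"
    by (simp_all add: P1 P2 masking_mat_def)
  have "P\<^sub>3 = P\<^sub>5"
  proof (rule eq_rowI)
    fix i assume "i < dim_row P\<^sub>5"
    then have i: "i < m\<^sub>1" by (simp add: P5 masking_mat_def)
    have "row P\<^sub>3 i = row P\<^sub>1 (i * m\<^sub>2)"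
      using assms(11)[OF i] i lt1[OF i] by (simp add: d1)
    \<comment> \<open>Iteration \<open>i * m\<^sub>2\<close> opens block \<open>i\<close>: as
      \<open>m\<^sub>2\<close> is positive, its quotient is \<open>i\<close>.\<close>
    also have "\<dots> = row P\<^sub>5 i"
      using i lt1[OF i] assms(3) by (simp add: P1 P5 row_masking_mat teim_pivot_def)
    finally show "row P\<^sub>3 i = row P\<^sub>5 i" .
  qed (simp_all add: P5 masking_mat_def)
  moreover have "P\<^sub>4 = P\<^sub>6"
  proof (rule eq_rowI)
    fix j assume "j < dim_row P\<^sub>6"
    then have j: "j < m\<^sub>2" by (simp add: P6 masking_mat_def)
    have "row P\<^sub>4 j = row P\<^sub>2 j"
      using assms(13)[OF j] j lt2[OF j] by (simp add: d1)
    \<comment> \<open>Iterations below \<open>m\<^sub>2\<close> form the first block, where the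
      remainder is \<open>j\<close> itself.\<close>
    also have "\<dots> = row P\<^sub>6 j"
      using j lt2[OF j] by (simp add: P2 P6 row_masking_mat teim_pivot_def)
    finally show "row P\<^sub>4 j = row P\<^sub>6 j" .
  qed (simp_all add: P6 masking_mat_def)
  ultimately show ?thesis ..
qed

end
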